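(* Let $X$ be a compact complex manifold with first Betti number $b^1\neq 0$. Then $h^{0,1}_{BC}=k^{0,1}$.
   Context: On smooth complex-valued $(p,q)$-forms on $X$, define $H^{p,q}_{BC}=(\ker(\partial)\cap\ker(\bar\partial))/\operatorname{im}(\partial\bar\partial)$ and $$K^{p,q}=\frac{\ker(\partial)\cap\ker(\bar\partial)}{\operatorname{im}(\partial)\cap\ker(\bar\partial)+\operatorname{im}(\bar\partial)\cap\ker(\partial)},$$ all spaces being taken in bidegree $(p,q)$, with complex dimensions $h^{p,q}_{BC}$ and $k^{p,q}$. *)

theory Defs
  imports "HOL-Analysis.Analysis" "HOL-Library.Extended_Nat"
begin

subsection \<open>Complex manifolds\<close>

type_synonym ('a, 'n) chart = "'a set \<times> ('a \<Rightarrow> complex ^ 'n)"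

abbreviation cdom :: "('a, 'n) chart \<Rightarrow> 'a set"
  where "cdom \<equiv> fst"

abbreviation cmap :: "('a, 'n) chart \<Rightarrow> 'a \<Rightarrow> complex ^ 'n"
  where "cmap \<equiv> snd"

definition cimg :: "('a, 'n) chart \<Rightarrow> (complex ^ 'n) set"
  where "cimg c = cmap c ` cdom c"

definition transition :: "('a, 'n) chart \<Rightarrow> ('a, 'n) chart \<Rightarrow> complex ^ 'n \<Rightarrow> complex ^ 'n"
  where "transition c c' = cmap c' \<circ> inv_into (cdom c) (cmap c)"

definition mv_holomorphic_on ::
    "(complex ^ 'n::finite \<Rightarrow> complex ^ 'm::finite) \<Rightarrow> (complex ^ 'n) set \<Rightarrow> bool"
  where "mv_holomorphic_on f S \<longleftrightarrow>
    (\<forall>x\<in>S. \<exists>f'. (f has_derivative f') (at x) \<and> (\<forall>a v. f' (a *s v) = a *s f' v))"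

definition complex_manifold :: "'a topology \<Rightarrow> ('a, 'n::finite) chart set \<Rightarrow> bool"
  where "complex_manifold X A \<longleftrightarrow>
    Hausdorff_space X \<and> second_countable X \<and>
    (\<forall>c\<in>A. openin X (cdom c) \<and> open (cimg c) \<and>
       homeomorphic_map (subtopology X (cdom c)) (top_of_set (cimg c)) (cmap c)) \<and>
    (\<Union>c\<in>A. cdom c) = topspace X \<and>
    (\<forall>c\<in>A. \<forall>c'\<in>A.
       mv_holomorphic_on (transition c c') (cmap c ` (cdom c \<inter> cdom c')))"


subsection \<open>Smooth differential forms\<close>

text \<open>\<open>smooth_on\<close> is meant for open sets and refers to the underlying real
  differentiable structure.\<close>

fun Ck_on :: "nat \<Rightarrow> ('v::real_normed_vector \<Rightarrow> 'w::real_normed_vector) \<Rightarrow> 'v set \<Rightarrow> bool"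
  where
    "Ck_on 0 f S = continuous_on S f"
  | "Ck_on (Suc k) f S =
      ((\<forall>x\<in>S. f differentiable (at x)) \<and>
       (\<forall>v. Ck_on k (\<lambda>x. frechet_derivative f (at x) v) S))"

definition smooth_on :: "('v::real_normed_vector \<Rightarrow> 'w::real_normed_vector) \<Rightarrow> 'v set \<Rightarrow> bool"
  where "smooth_on f S \<longleftrightarrow> (\<forall>k. Ck_on k f S)"

text \<open>A complex-valued \<open>k\<close>-covector on the real vector space underlying \<open>\<complex>\<^sup>n\<close> is an alternating,
  real-multilinear function of \<open>k\<close> vectors, encoded as a function on lists that vanishes on lists
  of any other length.\<close>

type_synonym 'n covector = "(complex ^ 'n) list \<Rightarrow> complex"

definition alternating :: "nat \<Rightarrow> 'n::finite covector \<Rightarrow> bool"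
  where "alternating k \<alpha> \<longleftrightarrow>
    (\<forall>v. length v \<noteq> k \<longrightarrow> \<alpha> v = 0) \<and>
    (\<forall>v i. length v = k \<longrightarrow> i < k \<longrightarrow> linear (\<lambda>x. \<alpha> (v[i := x]))) \<and>
    (\<forall>v i j. length v = k \<longrightarrow> i < k \<longrightarrow> j < k \<longrightarrow> i \<noteq> j \<longrightarrow> v ! i = v ! j \<longrightarrow> \<alpha> v = 0)"

text \<open>A form is the family of its local representatives: \<open>\<omega> c x\<close> is the covector at the point with
  coordinates \<open>x\<close> in the chart \<open>c\<close>. It is normalised to zero where this is meaningless, so that
  equality of forms is equality of functions.\<close>

type_synonym ('a, 'n) form = "('a, 'n) chart \<Rightarrow> complex ^ 'n \<Rightarrow> 'n covector"

definition zero_form :: "('a, 'n) form"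
  where "zero_form = (\<lambda>c x v. 0)"

definition is_form :: "('a, 'n::finite) chart set \<Rightarrow> nat \<Rightarrow> ('a, 'n) form \<Rightarrow> bool"
  where "is_form A k \<omega> \<longleftrightarrow>
    (\<forall>c x v. \<not> (c \<in> A \<and> x \<in> cimg c) \<longrightarrow> \<omega> c x v = 0) \<and>
    (\<forall>c\<in>A. \<forall>x\<in>cimg c. alternating k (\<omega> c x)) \<and>
    (\<forall>c\<in>A. \<forall>v. smooth_on (\<lambda>x. \<omega> c x v) (cimg c)) \<and>
    (\<forall>c\<in>A. \<forall>c'\<in>A. \<forall>P\<in>cdom c \<inter> cdom c'. \<forall>v.
       \<omega> c (cmap c P) v =
       \<omega> c' (cmap c' P) (map (frechet_derivative (transition c c') (at (cmap c P))) v))"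

text \<open>Degrees and bidegrees are integers, the spaces being zero in negative degree.\<close>

definition forms :: "('a, 'n::finite) chart set \<Rightarrow> int \<Rightarrow> ('a, 'n) form set"
  where "forms A k = (if k < 0 then {zero_form} else {\<omega>. is_form A (nat k) \<omega>})"

definition wedge :: "(complex ^ 'n \<Rightarrow> complex) list \<Rightarrow> 'n covector"
  where "wedge \<theta> v =
    (if length v = length \<theta>
     then \<Sum>\<sigma> | \<sigma> permutes {..<length \<theta>}.
            of_int (sign \<sigma>) * (\<Prod>i<length \<theta>. (\<theta> ! i) (v ! \<sigma> i))
     else 0)"

text \<open>The covector \<open>dz\<^sub>I \<and> d\<close>\<open>z\<close>-bar\<open>\<^sub>J\<close> for multi-indices \<open>I\<close> and \<open>J\<close>.\<close>

definition dz_wedge :: "'n::finite list \<Rightarrow> 'n list \<Rightarrow> 'n covector"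
  where "dz_wedge I J = wedge (map (\<lambda>i v. v $ i) I @ map (\<lambda>j v. cnj (v $ j)) J)"

definition has_type :: "nat \<Rightarrow> nat \<Rightarrow> 'n::finite covector \<Rightarrow> bool"
  where "has_type p q \<alpha> \<longleftrightarrow>
    (\<exists>f. \<alpha> = (\<lambda>v. \<Sum>I | length I = p. \<Sum>J | length J = q. f I J * dz_wedge I J v))"

definition pq_forms :: "('a, 'n::finite) chart set \<Rightarrow> int \<Rightarrow> int \<Rightarrow> ('a, 'n) form set"
  where "pq_forms A p q =
    (if p < 0 \<or> q < 0 then {zero_form}
     else {\<omega> \<in> forms A (p + q). \<forall>c\<in>A. \<forall>x\<in>cimg c. has_type (nat p) (nat q) (\<omega> c x)})"


subsection \<open>The operators \<open>d\<close>, \<open>\<partial>\<close> and \<open>\<partial>\<close>-bar\<close>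

text \<open>The differential of a function and its complex-linear and conjugate-linear parts:
  \<open>D10 f x v = \<Sum>\<^sub>j (\<partial>f/\<partial>z\<^sub>j) v\<^sub>j\<close>, and similarly \<open>D01\<close> with the conjugate coordinates.\<close>

definition D :: "(complex ^ 'n::finite \<Rightarrow> complex) \<Rightarrow> complex ^ 'n \<Rightarrow> complex ^ 'n \<Rightarrow> complex"
  where "D f x v = frechet_derivative f (at x) v"

definition D10 :: "(complex ^ 'n::finite \<Rightarrow> complex) \<Rightarrow> complex ^ 'n \<Rightarrow> complex ^ 'n \<Rightarrow> complex"
  where "D10 f x v = (D f x v - \<i> * D f x (\<i> *s v)) / 2"

definition D01 :: "(complex ^ 'n::finite \<Rightarrow> complex) \<Rightarrow> complex ^ 'n \<Rightarrow> complex ^ 'n \<Rightarrow> complex"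
  where "D01 f x v = (D f x v + \<i> * D f x (\<i> *s v)) / 2"

text \<open>In a chart, \<open>ext \<Delta>\<close> sends \<open>f \<theta>\<close>, with \<open>\<theta>\<close> a constant covector such as
  \<^term>\<open>dz_wedge I J\<close>, to \<open>\<Delta>f \<and> \<theta>\<close>, the wedge product being expanded along its first factor.\<close>

definition ext ::
    "((complex ^ 'n::finite \<Rightarrow> complex) \<Rightarrow> complex ^ 'n \<Rightarrow> complex ^ 'n \<Rightarrow> complex)
     \<Rightarrow> ('a, 'n) chart set \<Rightarrow> ('a, 'n) form \<Rightarrow> ('a, 'n) form"
  where "ext \<Delta> A \<omega> c x v =
    (if c \<in> A \<and> x \<in> cimg c
     then \<Sum>i<length v. (-1) ^ i * \<Delta> (\<lambda>y. \<omega> c y (take i v @ drop (Suc i) v)) x (v ! i)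
     else 0)"

definition ext_d :: "('a, 'n::finite) chart set \<Rightarrow> ('a, 'n) form \<Rightarrow> ('a, 'n) form"
  where "ext_d = ext D"

definition del :: "('a, 'n::finite) chart set \<Rightarrow> ('a, 'n) form \<Rightarrow> ('a, 'n) form"
  where "del = ext D10"

definition delbar :: "('a, 'n::finite) chart set \<Rightarrow> ('a, 'n) form \<Rightarrow> ('a, 'n) form"
  where "delbar = ext D01"


subsection \<open>Cohomology and its dimensions\<close>

definition lin_comb :: "(('a, 'n) form \<Rightarrow> complex) \<Rightarrow> ('a, 'n) form set \<Rightarrow> ('a, 'n) form"
  where "lin_comb a B = (\<lambda>c x v. \<Sum>\<beta>\<in>B. a \<beta> * \<beta> c x v)"

text \<open>For complex subspaces \<open>W \<subseteq> V\<close>: the classes of the elements of the finite set \<open>B\<close> are pairwise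
  distinct and form a basis of the quotient \<open>V/W\<close>.\<close>

definition basis_mod :: "('a, 'n) form set \<Rightarrow> ('a, 'n) form set \<Rightarrow> ('a, 'n) form set \<Rightarrow> bool"
  where "basis_mod V W B \<longleftrightarrow> finite B \<and> B \<subseteq> V \<and>
    (\<forall>a. lin_comb a B \<in> W \<longrightarrow> (\<forall>\<beta>\<in>B. a \<beta> = 0)) \<and>
    (\<forall>\<omega>\<in>V. \<exists>a. (\<lambda>c x v. \<omega> c x v - lin_comb a B c x v) \<in> W)"

definition quot_dim :: "('a, 'n) form set \<Rightarrow> ('a, 'n) form set \<Rightarrow> enat"
  where "quot_dim V W =
    (if \<exists>B. basis_mod V W B then enat (card (SOME B. basis_mod V W B)) else \<infinity>)"

text \<open>The \<open>k\<close>-th Betti number, as the complex dimension of complex-valued de Rham cohomology.\<close>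

definition betti :: "('a, 'n::finite) chart set \<Rightarrow> int \<Rightarrow> enat"
  where "betti A k =
    quot_dim {\<omega> \<in> forms A k. ext_d A \<omega> = zero_form} (ext_d A ` forms A (k - 1))"

definition ker_del :: "('a, 'n::finite) chart set \<Rightarrow> int \<Rightarrow> int \<Rightarrow> ('a, 'n) form set"
  where "ker_del A p q = {\<omega> \<in> pq_forms A p q. del A \<omega> = zero_form}"

definition ker_delbar :: "('a, 'n::finite) chart set \<Rightarrow> int \<Rightarrow> int \<Rightarrow> ('a, 'n) form set"
  where "ker_delbar A p q = {\<omega> \<in> pq_forms A p q. delbar A \<omega> = zero_form}"

definition im_del :: "('a, 'n::finite) chart set \<Rightarrow> int \<Rightarrow> int \<Rightarrow> ('a, 'n) form set"
  where "im_del A p q = del A ` pq_forms A (p - 1) q"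

definition im_delbar :: "('a, 'n::finite) chart set \<Rightarrow> int \<Rightarrow> int \<Rightarrow> ('a, 'n) form set"
  where "im_delbar A p q = delbar A ` pq_forms A p (q - 1)"

definition im_del_delbar :: "('a, 'n::finite) chart set \<Rightarrow> int \<Rightarrow> int \<Rightarrow> ('a, 'n) form set"
  where "im_del_delbar A p q = (\<lambda>\<eta>. del A (delbar A \<eta>)) ` pq_forms A (p - 1) (q - 1)"

definition sum_space :: "('a, 'n) form set \<Rightarrow> ('a, 'n) form set \<Rightarrow> ('a, 'n) form set"
  where "sum_space V W = {(\<lambda>c x v. \<omega> c x v + \<eta> c x v) | \<omega> \<eta>. \<omega> \<in> V \<and> \<eta> \<in> W}"

definition h_BC :: "('a, 'n::finite) chart set \<Rightarrow> int \<Rightarrow> int \<Rightarrow> enat"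
  where "h_BC A p q = quot_dim (ker_del A p q \<inter> ker_delbar A p q) (im_del_delbar A p q)"

definition k_dim :: "('a, 'n::finite) chart set \<Rightarrow> int \<Rightarrow> int \<Rightarrow> enat"
  where "k_dim A p q =
    quot_dim (ker_del A p q \<inter> ker_delbar A p q)
      (sum_space (im_del A p q \<inter> ker_delbar A p q) (im_delbar A p q \<inter> ker_del A p q))"

end

theory Submission
  imports Defs "HOL-Complex_Analysis.Complex_Analysis"
begin

text \<open>In bidegree \<open>(0,1)\<close> the images of \<open>\<partial>\<close> and \<open>\<partial>\<partial>\<close>-bar vanish, so the two quotients agree as soon
  as every smooth function \<open>f\<close> with \<open>\<partial>\<partial>\<close>-bar \<open>f = 0\<close> satisfies \<open>\<partial>\<close>-bar \<open>f = 0\<close>. On a complex disc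
  such a function is \<open>F\<close> plus the conjugate of \<open>G\<close> with \<open>F\<close> and \<open>G\<close> holomorphic, so \<open>Re (a f)\<close> is the
  real part of a holomorphic function for every constant \<open>a\<close> and obeys the strong maximum principle.
  On a compact manifold it is therefore constant on every connected component.\<close>

section \<open>Harmonic functions of one complex variable\<close>

text \<open>Cauchy-Riemann: a real-linear map of the plane that commutes with \<open>\<i>\<close> at
  1 is multiplication by its value at 1.\<close>

lemma has_field_derivative_complexI:
  assumes "(f has_derivative L) (at z)" and "L \<i> = \<i> * L 1"
  shows "(f has_field_derivative L 1) (at z)"
proof -
  interpret L: bounded_linear L
    using assms(1) by (rule has_derivative_bounded_linear)
  have "L w = L 1 * w" for w
  proof -
    have "w = Re w *\<^sub>R 1 + Im w *\<^sub>R \<i>"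
      by (simp add: complex_eq_iff)
    then have "L w = Re w *\<^sub>R L 1 + Im w *\<^sub>R L \<i>"
      by (metis L.add L.scaleR)
    also have "\<dots> = L 1 * (of_real (Re w) + \<i> * of_real (Im w))"
      by (simp add: assms(2) scaleR_conv_of_real algebra_simps)
    finally show ?thesis
      by (simp flip: complex_eq)
  qed
  then have "L = (*) (L 1)"
    by (rule HOL.ext)
  with assms(1) show ?thesis
    unfolding has_field_derivative_def by metis
qed

text \<open>The function \<open>g\<close> is the z-bar derivative of \<open>h\<close>, and the
  condition on \<open>g'\<close> says that its z derivative vanishes. Hence the conjugate of
  \<open>g\<close> is holomorphic and has a primitive \<open>G\<close> on the convex set;
  subtracting \<open>cnj (G z)\<close> from \<open>h\<close> kills the z-bar derivative.\<close>

lemma harmonic_eq_holomorphic_plus_cnj: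
  fixes h :: "complex \<Rightarrow> complex"
  assumes "open S" "convex S"
    and h: "\<And>z. z \<in> S \<Longrightarrow> (h has_derivative h' z) (at z)"
    and g: "\<And>z. z \<in> S \<Longrightarrow> ((\<lambda>z. (h' z 1 + \<i> * h' z \<i>) / 2) has_derivative g' z) (at z)"
    and g': "\<And>z. z \<in> S \<Longrightarrow> g' z 1 = \<i> * g' z \<i>"
  obtains F G where "F holomorphic_on S" "G holomorphic_on S" "\<And>z. z \<in> S \<Longrightarrow> h z = F z + cnj (G z)"
proof -
  define g where "g = (\<lambda>z. (h' z 1 + \<i> * h' z \<i>) / 2)"
  have "((\<lambda>z. cnj (g z)) has_field_derivative cnj (g' z 1)) (at z)" if "z \<in> S" for z
  proof (rule has_field_derivative_complexI)
    show "((\<lambda>z. cnj (g z)) has_derivative (\<lambda>w. cnj (g' z w))) (at z)"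
      unfolding g_def by (rule has_derivative_cnj) (rule g[OF that])
    show "cnj (g' z \<i>) = \<i> * cnj (g' z 1)"
      by (simp add: g'[OF that])
  qed
  then have "(\<lambda>z. cnj (g z)) holomorphic_on S"
    using \<open>open S\<close> by (auto simp: holomorphic_on_open)
  then obtain G where G: "\<And>z. z \<in> S \<Longrightarrow> (G has_field_derivative cnj (g z)) (at z)"
    using holomorphic_convex_primitive'[OF \<open>convex S\<close> \<open>open S\<close>] \<open>open S\<close>
    by (metis at_within_open)
  \<comment> \<open>The factor 1 is kept so that the derivative has the form \<open>L 1\<close> for
    the real-linear derivative \<open>L\<close>.\<close>
  have "((\<lambda>z. h z - cnj (G z)) has_field_derivative h' z 1 - cnj (cnj (g z) * 1)) (at z)"
    if "z \<in> S" for z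
  proof (rule has_field_derivative_complexI)
    have "(G has_derivative (\<lambda>w. cnj (g z) * w)) (at z)"
      using G[OF that] by (simp add: has_field_derivative_def)
    then show "((\<lambda>z. h z - cnj (G z)) has_derivative (\<lambda>w. h' z w - cnj (cnj (g z) * w))) (at z)"
      by (intro has_derivative_diff has_derivative_cnj h that)
    show "h' z \<i> - cnj (cnj (g z) * \<i>) = \<i> * (h' z 1 - cnj (cnj (g z) * 1))"
      by (simp add: g_def field_simps)
  qed
  then have "(\<lambda>z. h z - cnj (G z)) holomorphic_on S"
    using \<open>open S\<close> by (auto simp: holomorphic_on_open)
  moreover have "G holomorphic_on S"
    using G \<open>open S\<close> by (auto simp: holomorphic_on_open)
  ultimately show ?thesis
    by (intro that[of "\<lambda>z. h z - cnj (G z)" G]) auto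
qed

text \<open>Conjugating the second term leaves the real part unchanged, so the quantity is the log
  modulus of the holomorphic function \<open>exp (a * F z + cnj a * G z)\<close>, and the maximum
  modulus principle applies.\<close>

lemma Re_holomorphic_plus_cnj_maximum:
  assumes "F holomorphic_on S" "G holomorphic_on S" "open S" "connected S" "z0 \<in> S" "z \<in> S"
    and max: "\<And>z. z \<in> S \<Longrightarrow> Re (a * (F z + cnj (G z))) \<le> Re (a * (F z0 + cnj (G z0)))"
  shows "Re (a * (F z + cnj (G z))) = Re (a * (F z0 + cnj (G z0)))"
proof -
  define E where "E = (\<lambda>z. exp (a * F z + cnj a * G z))"
  have E: "norm (E z) = exp (Re (a * (F z + cnj (G z))))" for z
    by (simp add: E_def algebra_simps)
  have "E holomorphic_on S"
    unfolding E_def by (intro holomorphic_intros assms)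
  then have "E constant_on S"
    by (rule maximum_modulus_principle[where U = S and \<xi> = z0]) (use assms E in auto)
  then have "norm (E z) = norm (E z0)"
    using assms by (auto simp: constant_on_def)
  then show ?thesis
    by (simp only: E exp_inj_iff)
qed

section \<open>Maximum principle on balls by restriction to complex lines\<close>

lemma norm_vector_scalar_mult_complex:
  fixes v :: "complex ^ 'n::finite"
  shows "norm (a *s v) = norm a * norm v"
  by (simp add: norm_vec_def L2_set_right_distrib norm_mult)

lemma bounded_linear_vector_scalar_mult_left:
  "bounded_linear (\<lambda>w. w *s (v :: complex ^ 'n::finite))"
  unfolding linear_conv_bounded_linear[symmetric]
  by (rule linearI) (simp_all add: vec_eq_iff algebra_simps)

lemma Ck_on_2_D01:
  assumes "Ck_on 2 f S" "x \<in> S"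
  shows "f differentiable (at x)" "(\<lambda>y. D01 f y v) differentiable (at x)"
proof -
  have C: "\<forall>x\<in>S. f differentiable (at x)"
    "\<And>v. \<forall>x\<in>S. (\<lambda>y. D f y v) differentiable (at x)"
    using assms(1) by (auto simp: numeral_2_eq_2 D_def)
  then show "f differentiable (at x)" "(\<lambda>y. D01 f y v) differentiable (at x)"
    using assms(2) unfolding D01_def
    by (auto intro!: derivative_intros differentiable_divide)
qed

text \<open>On the complex line through \<open>x0\<close> and \<open>y\<close>, the second-order
  condition in the direction \<open>v\<close> becomes Laplace's equation in one variable.\<close>

lemma pluriharmonic_maximum:
  fixes f :: "complex ^ 'n::finite \<Rightarrow> complex"
  assumes C2: "Ck_on 2 f (ball x0 r)"
    and ph: "\<And>x v. x \<in> ball x0 r \<Longrightarrow> D10 (\<lambda>y. D01 f y v) x v = 0"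
    and max: "\<And>y. y \<in> ball x0 r \<Longrightarrow> Re (a * f y) \<le> Re (a * f x0)"
    and y: "y \<in> ball x0 r"
  shows "Re (a * f y) = Re (a * f x0)"
proof (cases "y = x0")
  case False
  define v where "v = y - x0"
  \<comment> \<open>The disc of radius \<open>R\<close> is mapped by \<open>l\<close> into the ball.
    Since \<open>norm v < r\<close>, it contains the parameter 1, which gives
    \<open>y\<close>.\<close>
  define R where "R = r / norm v"
  have v: "norm v > 0" "norm v < r"
    using False y by (auto simp: v_def dist_norm norm_minus_commute)
  define l where "l = (\<lambda>z. x0 + z *s v)"
  have l: "l z \<in> ball x0 r" if "z \<in> ball (0::complex) R" for z
    using that v by (simp add: l_def R_def dist_norm norm_vector_scalar_mult_complex field_simps)
  have "R > 1"
    using v by (simp add: R_def)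
  then have l01: "0 \<in> ball (0::complex) R" "1 \<in> ball (0::complex) R" "l 0 = x0" "l 1 = y"
    by (simp_all add: l_def v_def dist_norm)
  have dl: "(l has_derivative (\<lambda>w. w *s v)) (at z)" for z
    unfolding l_def
    using bounded_linear_imp_has_derivative[OF bounded_linear_vector_scalar_mult_left[of v], of "at z"]
    by (auto intro!: derivative_eq_intros)
  have chain: "((\<lambda>z. \<phi> (l z)) has_derivative (\<lambda>w. D \<phi> (l z) (w *s v))) (at z)"
    if "\<phi> differentiable (at (l z))" for z \<phi>
  proof -
    have "(\<phi> has_derivative D \<phi> (l z)) (at (l z))"
      using that by (simp add: frechet_derivative_works D_def[abs_def])
    from has_derivative_compose[OF dl this] show ?thesis .
  qed
  obtain F G where FG: "F holomorphic_on ball 0 R" "G holomorphic_on ball 0 R"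
    "\<And>z. z \<in> ball 0 R \<Longrightarrow> f (l z) = F z + cnj (G z)"
  proof (rule harmonic_eq_holomorphic_plus_cnj[of "ball 0 R" "\<lambda>z. f (l z)"
        "\<lambda>z w. D f (l z) (w *s v)" "\<lambda>z w. D (\<lambda>y. D01 f y v) (l z) (w *s v)"])
    fix z :: complex assume z: "z \<in> ball 0 R"
    show "((\<lambda>z. f (l z)) has_derivative (\<lambda>w. D f (l z) (w *s v))) (at z)"
      by (rule chain) (rule Ck_on_2_D01[OF C2 l[OF z]])
    \<comment> \<open>The z-bar derivative along the line is \<open>D01 f (l z) v\<close>, so the
      chain rule applies to it as a function on the ball.\<close>
    show "((\<lambda>z. (D f (l z) (1 *s v) + \<i> * D f (l z) (\<i> *s v)) / 2) has_derivative
        (\<lambda>w. D (\<lambda>y. D01 f y v) (l z) (w *s v))) (at z)"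
      using chain[OF Ck_on_2_D01(2)[OF C2 l[OF z]], of v] by (simp add: D01_def)
    show "D (\<lambda>y. D01 f y v) (l z) (1 *s v) = \<i> * D (\<lambda>y. D01 f y v) (l z) (\<i> *s v)"
      using ph[OF l[OF z], of v] by (simp add: D10_def)
  qed auto
  have "Re (a * (F 1 + cnj (G 1))) = Re (a * (F 0 + cnj (G 0)))"
  proof (rule Re_holomorphic_plus_cnj_maximum[OF FG(1,2)])
    fix z :: complex assume "z \<in> ball 0 R"
    then show "Re (a * (F z + cnj (G z))) \<le> Re (a * (F 0 + cnj (G 0)))"
      using max[OF l] FG(3) FG(3)[OF l01(1)] l01(3) by metis
  qed (use l01 in auto)
  then show ?thesis
    using FG(3)[OF l01(1)] FG(3)[OF l01(2)] l01(3,4) by simp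
qed simp

section \<open>Maximum principle on compact spaces, and coordinate balls\<close>

text \<open>Connected components are closed, hence compact, so \<open>u\<close> attains a maximum on
  each. The set where it is attained is closed by continuity and open by the local principle, so it
  fills the component.\<close>

lemma compact_space_maximum_principle:
  fixes u :: "'a \<Rightarrow> real"
  assumes "compact_space X" and u: "continuous_map X euclideanreal u"
    and loc: "\<And>P. P \<in> topspace X \<Longrightarrow> \<exists>B. openin X B \<and> connectedin X B \<and> P \<in> B \<and>
      ((\<forall>Q\<in>B. u Q \<le> u P) \<longrightarrow> (\<forall>Q\<in>B. u Q = u P))"
    and S: "connectedin X S" "P \<in> S" "Q \<in> S"
  shows "u P = u Q"
proof -
  define C where "C = connected_component_of_set X P"
  have P: "P \<in> topspace X"
    using S connectedin_subset_topspace by blast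
  have C: "S \<subseteq> C" "connectedin X C" "closedin X C" "C \<subseteq> topspace X"
    using S unfolding C_def
    by (auto simp: connected_component_of_maximal connectedin_connected_component_of
        closedin_connected_component_of connected_component_of_subset_topspace)
  have "compact (u ` C)"
    using image_compactin[OF closedin_compact_space[OF assms(1) C(3)] u] by simp
  moreover have "u ` C \<noteq> {}"
    using S C by auto
  ultimately obtain P0 where P0: "P0 \<in> C" "\<And>Q. Q \<in> C \<Longrightarrow> u Q \<le> u P0"
    using compact_attains_sup[of "u ` C"] by auto
  define T where "T = C \<inter> {Q \<in> topspace X. u Q \<in> {u P0}}"
  have "closedin X T"
    unfolding T_def
    by (intro closedin_Int C closedin_continuous_map_preimage[OF u]) auto
  moreover have "openin X T"
  proof (subst openin_subopen, intro ballI)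
    fix Q assume "Q \<in> T"
    then have Q: "Q \<in> C" "u Q = u P0" "Q \<in> topspace X"
      by (auto simp: T_def)
    obtain B where B: "openin X B" "connectedin X B" "Q \<in> B"
      "(\<forall>R\<in>B. u R \<le> u Q) \<longrightarrow> (\<forall>R\<in>B. u R = u Q)"
      using loc[OF Q(3)] by blast
    \<comment> \<open>Being connected, \<open>B\<close> stays inside the component, where the value
      at \<open>Q\<close> is maximal; this supplies the premise of the local principle.\<close>
    have "connected_component_of X P = connected_component_of X Q"
      using Q(1) by (simp add: C_def connected_component_of_equiv)
    then have "B \<subseteq> C"
      using connected_component_of_maximal[OF B(2,3)] by (simp add: C_def)
    have "B \<subseteq> T"
    proof -
      have "\<forall>R\<in>B. u R \<le> u Q"
        using \<open>B \<subseteq> C\<close> P0(2) Q(2) by auto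
      with B(4) Q(2) have "\<forall>R\<in>B. u R = u P0"
        by metis
      with \<open>B \<subseteq> C\<close> C(4) show ?thesis
        unfolding T_def by blast
    qed
    then show "\<exists>B. openin X B \<and> Q \<in> B \<and> B \<subseteq> T"
      using B by blast
  qed
  ultimately have "C \<subseteq> T \<or> disjnt C T"
    by (rule connectedin_clopen_cases[OF C(2)])
  moreover have "P0 \<in> T"
    using P0(1) C(4) by (auto simp: T_def)
  ultimately have "C \<subseteq> T"
    using P0(1) by (auto simp: disjnt_iff)
  then show ?thesis
    using S C(1) unfolding T_def by (metis (mono_tags, lifting) IntE mem_Collect_eq singletonD subsetD)
qed

text \<open>Charts are homeomorphisms onto open sets, so balls pull back to the connected
  neighbourhoods that the local principle asks for.\<close>

lemma chart_ball_openin_connectedin: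
  assumes "complex_manifold X A" "c \<in> A" "ball x r \<subseteq> cimg c"
  shows "openin X {P \<in> cdom c. cmap c P \<in> ball x r}"
    and "connectedin X {P \<in> cdom c. cmap c P \<in> ball x r}"
proof -
  let ?B = "{P \<in> cdom c. cmap c P \<in> ball x r}"
  have c: "openin X (cdom c)" "open (cimg c)"
    "homeomorphic_map (subtopology X (cdom c)) (top_of_set (cimg c)) (cmap c)"
    using assms(1,2) unfolding complex_manifold_def by auto
  have img: "cmap c ` ?B = ball x r"
    using assms(3) by (fastforce simp: cimg_def)
  have sub: "?B \<subseteq> topspace (subtopology X (cdom c))"
    using openin_subset[OF c(1)] by auto
  have "openin (top_of_set (cimg c)) (cmap c ` ?B)"
    unfolding img using assms(3) by (auto intro: open_subset)
  then have "openin (subtopology X (cdom c)) ?B"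
    using homeomorphic_map_openness[OF c(3) sub] by simp
  then show "openin X ?B"
    using c(1) by (simp add: openin_open_subtopology)
  have "connectedin (top_of_set (cimg c)) (cmap c ` ?B)"
    unfolding img using assms(3) by (simp add: connectedin_subtopology)
  then have "connectedin (subtopology X (cdom c)) ?B"
    using homeomorphic_map_connectedness[OF c(3) sub] by simp
  then show "connectedin X ?B"
    by (simp add: connectedin_subtopology)
qed

section \<open>From forms to second derivatives in a chart\<close>

lemma vector_scalar_mult_ii_ii: "\<i> *s (\<i> *s v) = - (v :: complex ^ 'n)"
  by (simp add: vec_eq_iff flip: mult.assoc)

lemma D01_vector_scalar_mult_ii:
  assumes "f differentiable (at x)"
  shows "D01 f x (\<i> *s v) = - \<i> * D01 f x v"
proof -
  interpret bounded_linear "D f x"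
    using assms by (metis D_def[abs_def] frechet_derivative_works has_derivative_bounded_linear)
  have "D f x (\<i> *s (\<i> *s v)) = - D f x v"
    by (simp only: vector_scalar_mult_ii_ii neg)
  then show ?thesis
    by (simp add: D01_def field_simps)
qed

lemma D10_vector_scalar_mult_ii:
  assumes "f differentiable (at x)"
  shows "D10 f x (\<i> *s v) = \<i> * D10 f x v"
proof -
  interpret bounded_linear "D f x"
    using assms by (metis D_def[abs_def] frechet_derivative_works has_derivative_bounded_linear)
  have "D f x (\<i> *s (\<i> *s v)) = - D f x v"
    by (simp only: vector_scalar_mult_ii_ii neg)
  then show ?thesis
    by (simp add: D10_def field_simps)
qed

lemma D10_mult_left:
  assumes "f differentiable (at x)"
  shows "D10 (\<lambda>y. a * f y) x v = a * D10 f x v"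
proof -
  have "((\<lambda>y. a * f y) has_derivative (\<lambda>v. a * D f x v)) (at x)"
    using assms by (intro has_derivative_mult_right) (simp add: frechet_derivative_works D_def[abs_def])
  then have "D (\<lambda>y. a * f y) x v = a * D f x v" for v
    unfolding D_def by (metis frechet_derivative_at)
  then show ?thesis
    by (simp add: D10_def field_simps)
qed

text \<open>Serves to replace \<open>delbar A \<omega>\<close> by its formula, which holds only on
  the open set \<open>cimg c\<close> because forms are set to zero elsewhere.\<close>

lemma D_cong_open:
  assumes "f differentiable (at x)" "open S" "x \<in> S" "\<And>y. y \<in> S \<Longrightarrow> f y = g y"
  shows "D f x v = D g x v"
proof -
  have "(f has_derivative D f x) (at x)"
    using assms(1) by (simp add: frechet_derivative_works D_def[abs_def])
  then have "(g has_derivative D f x) (at x)"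
    by (rule has_derivative_transform_within_open) (use assms in auto)
  then show ?thesis
    unfolding D_def by (metis frechet_derivative_at)
qed

lemma D_zero [simp]: "D (\<lambda>y. 0) x v = 0"
  by (simp add: D_def)

lemma D01_zero [simp]: "D01 (\<lambda>y. 0) x v = 0"
  by (simp add: D01_def)

lemma D10_zero [simp]: "D10 (\<lambda>y. 0) x v = 0"
  by (simp add: D10_def)

text \<open>Write \<open>H\<close> for the second derivative in question. Evaluated on the pair
  \<open>v\<close>, \<open>\<i> *s v\<close>, the 2-form is an alternating difference whose two
  terms are \<open>- \<i> * H\<close> and \<open>\<i> * H\<close>; it equals
  \<open>- 2 * \<i> * H\<close>, so its vanishing forces \<open>H = 0\<close>.\<close>

lemma pluriharmonic_of_del_delbar_eq_zero:
  assumes "c \<in> A" "open (cimg c)" "x \<in> cimg c" "smooth_on (\<lambda>y. \<omega> c y []) (cimg c)"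
    and dd: "del A (delbar A \<omega>) = zero_form"
  shows "D10 (\<lambda>y. D01 (\<lambda>y. \<omega> c y []) y v) x v = 0"
proof -
  let ?f = "\<lambda>y. \<omega> c y []"
  let ?g = "\<lambda>w y. D01 ?f y w"
  have "Ck_on 2 ?f (cimg c)"
    using assms(4) by (simp add: smooth_on_def)
  note diff = Ck_on_2_D01[OF this]
  have delbar: "?g w y = delbar A \<omega> c y [w]" if "y \<in> cimg c" for y w
    using that assms(1) by (simp add: delbar_def ext_def)
  have cong: "D10 (\<lambda>y. delbar A \<omega> c y [w]) x = D10 (?g w) x" for w
    using D_cong_open[OF diff(2)[OF assms(3)] assms(2,3) delbar]
    by (simp add: D10_def[abs_def])
  \<comment> \<open>Here \<open>\<i> *s v\<close> sits in the conjugate-linear slot, which produces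
    the factor \<open>- \<i>\<close>; the complex-linear slot produces \<open>\<i>\<close>.\<close>
  have "D10 (?g (\<i> *s v)) x v = D10 (\<lambda>y. - \<i> * ?g v y) x v"
    using D_cong_open[OF diff(2)[OF assms(3)] assms(2,3) D01_vector_scalar_mult_ii[OF diff(1)]]
    by (simp add: D10_def)
  also have "\<dots> = - \<i> * D10 (?g v) x v"
    by (rule D10_mult_left[OF diff(2)[OF assms(3)]])
  finally have 1: "D10 (?g (\<i> *s v)) x v = - \<i> * D10 (?g v) x v" .
  have "del A (delbar A \<omega>) c x [v, \<i> *s v] = 0"
    by (simp add: dd zero_form_def)
  then have "D10 (?g (\<i> *s v)) x v - D10 (?g v) x (\<i> *s v) = 0"
    using assms(1,3) by (simp add: del_def ext_def cong numeral_2_eq_2)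
  then show ?thesis
    by (simp add: 1 D10_vector_scalar_mult_ii[OF diff(2)[OF assms(3)]])
qed

section \<open>The zero form\<close>

lemma ext_zero_form:
  assumes "\<And>x v. \<Delta> (\<lambda>y. 0) x v = 0"
  shows "ext \<Delta> A zero_form = zero_form"
  by (intro HOL.ext) (simp add: Defs.ext_def zero_form_def assms)

lemma del_zero_form [simp]: "del A zero_form = zero_form"
  and delbar_zero_form [simp]: "delbar A zero_form = zero_form"
  by (simp_all add: del_def delbar_def ext_zero_form)

lemma Ck_on_subset: "Ck_on k f S \<Longrightarrow> T \<subseteq> S \<Longrightarrow> Ck_on k f T"
  by (induction k arbitrary: f) (auto intro: continuous_on_subset)

lemma Ck_on_zero: "Ck_on k (\<lambda>x. 0) S"
  by (induction k) auto

lemma zero_form_in_pq_forms [simp]: "(zero_form :: ('a, 'b::finite) form) \<in> pq_forms A p q"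
proof -
  have "is_form A k zero_form" for k
    by (simp add: is_form_def zero_form_def alternating_def smooth_on_def Ck_on_zero linear_0
        linear_iff)
  moreover have "has_type k l ((zero_form :: ('a, 'b) form) c x)" for k l c x
    unfolding has_type_def zero_form_def by (rule exI[of _ "\<lambda>I J. 0"]) simp
  ultimately show ?thesis
    by (simp add: pq_forms_def forms_def)
qed

section \<open>Global argument on the compact manifold\<close>

text \<open>A 0-form is a global function; the maximum principle, applied to all its real parts
  \<open>Re (a * F P)\<close>, makes it locally constant.\<close>

lemma delbar_eq_zero_form:
  assumes X: "complex_manifold X A" "compact_space X" and \<omega>: "is_form A 0 \<omega>"
    and dd: "del A (delbar A \<omega>) = zero_form"
  shows "delbar A \<omega> = zero_form"
proof -
  have chart: "openin X (cdom c)" "open (cimg c)"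
    "homeomorphic_map (subtopology X (cdom c)) (top_of_set (cimg c)) (cmap c)" if "c \<in> A" for c
    using X(1) that unfolding complex_manifold_def by auto
  have cover: "\<exists>c. c \<in> A \<and> P \<in> cdom c" if "P \<in> topspace X" for P
    using X(1) that unfolding complex_manifold_def by blast
  have smooth: "smooth_on (\<lambda>x. \<omega> c x []) (cimg c)" if "c \<in> A" for c
    using \<omega> that by (auto simp: is_form_def)
  \<comment> \<open>On the empty argument list the change of coordinates has no tangent vector to
    act on.\<close>
  have compat: "\<omega> c (cmap c P) [] = \<omega> c' (cmap c' P) []"
    if "c \<in> A" "c' \<in> A" "P \<in> cdom c" "P \<in> cdom c'" for c c' P
  proof -
    have "\<forall>v. \<omega> c (cmap c P) v =
        \<omega> c' (cmap c' P) (map (frechet_derivative (transition c c') (at (cmap c P))) v)"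
      using \<omega> that unfolding is_form_def by blast
    from spec[OF this, of "[]"] show ?thesis
      by simp
  qed
  define chart_at where "chart_at P = (SOME c. c \<in> A \<and> P \<in> cdom c)" for P
  have chart_at: "chart_at P \<in> A \<and> P \<in> cdom (chart_at P)" if "P \<in> topspace X" for P
    unfolding chart_at_def by (rule someI_ex) (rule cover[OF that])
  define F where "F P = \<omega> (chart_at P) (cmap (chart_at P) P) []" for P
  have F: "F P = \<omega> c (cmap c P) []" if "c \<in> A" "P \<in> cdom c" for c P
    unfolding F_def using that chart_at[of P] openin_subset[OF chart(1)[OF that(1)]]
    by (intro compat) auto
  have contF: "continuous_map X euclidean F"
  proof (rule pasting_lemma[where I = A and T = cdom and f = "\<lambda>c P. \<omega> c (cmap c P) []"])
    fix c assume c: "c \<in> A"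
    have "Ck_on 0 (\<lambda>x. \<omega> c x []) (cimg c)"
      using smooth[OF c] unfolding smooth_on_def by blast
    then have "continuous_map (top_of_set (cimg c)) euclidean (\<lambda>x. \<omega> c x [])"
      by simp
    from continuous_map_compose[OF homeomorphic_imp_continuous_map[OF chart(3)[OF c]] this]
    show "continuous_map (subtopology X (cdom c)) euclidean (\<lambda>P. \<omega> c (cmap c P) [])"
      by (simp add: o_def)
  next
    show "\<exists>c. c \<in> A \<and> P \<in> cdom c \<and> F P = \<omega> c (cmap c P) []" if "P \<in> topspace X" for P
      using cover[OF that] F by blast
    show "\<omega> c (cmap c P) [] = \<omega> c' (cmap c' P) []"
      if "c \<in> A" "c' \<in> A" "P \<in> topspace X \<inter> cdom c \<inter> cdom c'" for c c' P
      using that by (intro compat) simp_all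
  qed (rule chart(1))
  \<comment> \<open>The factor \<open>a\<close> stays arbitrary: the values 1 and
    \<open>- \<i>\<close> later recover the real and imaginary parts of \<open>F\<close>.\<close>
  have const: "Re (a * F P) = Re (a * F Q)"
    if S: "connectedin X S" "P \<in> S" "Q \<in> S" for a P Q S
  proof (rule compact_space_maximum_principle[OF X(2) _ _ S])
    show "continuous_map X euclideanreal (\<lambda>P. Re (a * F P))"
      using continuous_map_compose[OF contF, of euclideanreal "\<lambda>z. Re (a * z)"]
      by (simp add: o_def continuous_intros)
    fix P assume "P \<in> topspace X"
    then obtain c where c: "c \<in> A" "P \<in> cdom c"
      using cover by blast
    then have "cmap c P \<in> cimg c"
      by (auto simp: cimg_def)
    then obtain r where r: "r > 0" "ball (cmap c P) r \<subseteq> cimg c"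
      using chart(2)[OF c(1)] open_contains_ball by blast
    let ?f = "\<lambda>x. \<omega> c x []"
    let ?B = "{Q \<in> cdom c. cmap c Q \<in> ball (cmap c P) r}"
    have local_max: "Re (a * F Q) = Re (a * F P)"
      if max: "\<forall>Q\<in>?B. Re (a * F Q) \<le> Re (a * F P)" and Q: "Q \<in> ?B" for Q
    proof -
      \<comment> \<open>In the coordinates of \<open>c\<close> the claim becomes the maximum
        principle on a Euclidean ball centred at the image of \<open>P\<close>.\<close>
      have "Re (a * ?f (cmap c Q)) = Re (a * ?f (cmap c P))"
      proof (rule pluriharmonic_maximum)
        show "Ck_on 2 ?f (ball (cmap c P) r)"
          using smooth[OF c(1)] r(2) by (auto simp: smooth_on_def intro: Ck_on_subset)
        show "D10 (\<lambda>y. D01 ?f y v) x v = 0" if "x \<in> ball (cmap c P) r" for x v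
          by (rule pluriharmonic_of_del_delbar_eq_zero[OF c(1) chart(2)[OF c(1)] _ smooth[OF c(1)] dd])
            (use that r in auto)
        show "Re (a * ?f y) \<le> Re (a * ?f (cmap c P))" if "y \<in> ball (cmap c P) r" for y
        proof -
          have "y \<in> cimg c"
            using that r(2) by blast
          then obtain R where R: "R \<in> cdom c" "y = cmap c R"
            unfolding cimg_def by blast
          then have "Re (a * F R) \<le> Re (a * F P)"
            using max that by blast
          then show ?thesis
            using R by (simp add: F[OF c(1)] c(2))
        qed
      qed (use Q in auto)
      then show ?thesis
        using Q by (simp add: F[OF c(1)] c(2))
    qed
    show "\<exists>B. openin X B \<and> connectedin X B \<and> P \<in> B \<and>
        ((\<forall>Q\<in>B. Re (a * F Q) \<le> Re (a * F P)) \<longrightarrow> (\<forall>Q\<in>B. Re (a * F Q) = Re (a * F P)))"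
    proof (intro exI[of _ ?B] conjI impI ballI)
      show "P \<in> ?B"
        using c(2) r(1) by simp
    qed (fact chart_ball_openin_connectedin[OF X(1) c(1) r(2)] local_max)+
  qed
  have D01: "D01 (\<lambda>y. \<omega> c y []) x v = 0" if c: "c \<in> A" "x \<in> cimg c" for c x v
  proof -
    obtain r where r: "r > 0" "ball x r \<subseteq> cimg c"
      using chart(2)[OF c(1)] c(2) open_contains_ball by blast
    have eq: "\<omega> c y [] = \<omega> c x []" if y: "y \<in> ball x r" for y
    proof -
      let ?B = "{Q \<in> cdom c. cmap c Q \<in> ball x r}"
      have "y \<in> cimg c"
        using y r(2) by blast
      then obtain Q where Q: "Q \<in> cdom c" "y = cmap c Q"
        unfolding cimg_def by blast
      obtain P where P: "P \<in> cdom c" "x = cmap c P"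
        using c(2) unfolding cimg_def by blast
      have PQ: "Q \<in> ?B" "P \<in> ?B"
        using P Q y r(1) by simp_all
      have "Re (a * F Q) = Re (a * F P)" for a
        by (rule const[OF chart_ball_openin_connectedin(2)[OF X(1) c(1) r(2)] PQ])
      from this[of 1] this[of "- \<i>"] have "F Q = F P"
        by (simp add: complex_eq_iff)
      then show ?thesis
        using P Q by (simp add: F[OF c(1)])
    qed
    \<comment> \<open>The constant comes first because \<open>D_cong_open\<close> asks for
      differentiability of its first function.\<close>
    have "D (\<lambda>y. \<omega> c x []) x v = D (\<lambda>y. \<omega> c y []) x v" for v
      by (rule D_cong_open[OF _ open_ball _ eq[symmetric]]) (simp_all add: r(1))
    then show ?thesis
      by (simp add: D01_def) (simp add: D_def)
  qed
  have zero: "\<omega> c y w = 0" if "w \<noteq> []" for c y w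
    using \<omega> that unfolding is_form_def alternating_def by (metis length_0_conv)
  show ?thesis
  proof (intro HOL.ext)
    fix c x v
    have "D01 (\<lambda>y. \<omega> c y (take i v @ drop (Suc i) v)) x (v ! i) = 0"
      if "c \<in> A" "x \<in> cimg c" "i < length v" for i
    \<comment> \<open>Deleting the only entry of a one-element list leaves \<open>[]\<close>, where
      \<open>D01\<close> vanishes as shown; from any longer list a non-empty one remains, on which a
      0-form is zero by normalisation.\<close>
    proof (cases "length v = 1")
      case True
      then show ?thesis
        using that D01 by simp
    next
      case False
      then have "take i v @ drop (Suc i) v \<noteq> []"
        using that(3) by auto
      then show ?thesis
        by (simp add: zero del: append_is_Nil_conv)
    qed
    then show "delbar A \<omega> c x v = zero_form c x v"
      by (simp add: delbar_def Defs.ext_def zero_form_def)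
  qed
qed

section \<open>Comparison of the two quotients\<close>

theorem proposition3p2:
  fixes X :: "'a topology" and A :: "('a, 'n::finite) chart set"
  assumes "complex_manifold X A"
    and "compact_space X"
    and "betti A 1 \<noteq> 0"
  shows "h_BC A 0 1 = k_dim A 0 1"
proof -
  \<comment> \<open>The source has first degree -1, where \<open>pq_forms\<close> is
    \<open>{zero_form}\<close>; the same holds for \<open>im_del\<close>.\<close>
  have "im_del_delbar A 0 1 = {zero_form}"
    by (simp add: im_del_delbar_def pq_forms_def)
  moreover have "im_del A 0 1 \<inter> ker_delbar A 0 1 = {zero_form}"
    by (auto simp: im_del_def ker_delbar_def pq_forms_def[of A "-1"])
  \<comment> \<open>An element is \<open>delbar A \<omega>\<close> for a function
    \<open>\<omega>\<close> annihilated by \<open>\<partial>\<close> after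
    \<open>\<partial>\<close>-bar, hence zero by the global argument.\<close>
  moreover have "im_delbar A 0 1 \<inter> ker_del A 0 1 = {zero_form}"
  proof -
    have "delbar A \<omega> = zero_form" if "\<omega> \<in> pq_forms A 0 0" "del A (delbar A \<omega>) = zero_form" for \<omega>
      using that delbar_eq_zero_form[OF assms(1,2)] by (auto simp: pq_forms_def forms_def)
    moreover have "zero_form \<in> delbar A ` pq_forms A 0 0"
      by (metis delbar_zero_form imageI zero_form_in_pq_forms)
    ultimately show ?thesis
      by (auto simp: im_delbar_def ker_del_def)
  qed
  moreover have "sum_space {zero_form} {zero_form} = {zero_form :: ('a, 'n) form}"
    by (auto simp: sum_space_def zero_form_def)
  \<comment> \<open>Both sides are now \<open>quot_dim\<close> of the same pair of spaces, so they
    agree whether finite or infinite.\<close>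
  ultimately show ?thesis
    by (simp add: h_BC_def k_dim_def)
qed

end
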